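(* Let $\mathbf{A}=[a_{ij}]$ be an $n\times n$ pairwise comparison matrix and $\mathbf{w}=(w_1,\dots,w_n)^{\top}$ a positive weight vector such that $a_{ij}\ne w_i/w_j$ for all $i\ne j$. Let $I=\{(i,j)\mid a_{ij}<w_i/w_j\}$, and put $v_i=\log w_i$ for $1\le i\le n$ and $b_{ij}=\log a_{ij}$ for $1\le i,j\le n$. Consider the linear program in the variables $y_i\in\mathbb{R}$ ($1\le i\le n$) and $s$: \begin{align*} \min\ -s&\\ y_j-y_i&\le -b_{ij} &&\text{for all }(i,j)\in I,\\ y_i-y_j+s&\le v_i-v_j &&\text{for all }(i,j)\in I,\\ s&\ge 0,\\ y_1&=0. \end{align*} The optimum value of this linear program is at most $0$, and it is equal to $0$ if and only if $\mathbf{w}$ is weakly efficient with respect to $\mathbf{A}$. Moreover, let $(\mathbf{y}^{\ast},s^{\ast})\in\mathbb{R}^{n+1}$ be an optimal solution; if $\mathbf{w}$ is strongly inefficient, then the weight vector $\exp(\mathbf{y}^{\ast})=(e^{y_1^{\ast}},\dots,e^{y_n^{\ast}})^{\top}$ is weakly efficient and dominates $\mathbf{w}$ internally and strictly.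
   Context: A pairwise comparison matrix of size $n\times n$ ($n\ge 3$) is a real matrix $\mathbf{A}=[a_{ij}]$ with all entries positive and $a_{ij}=1/a_{ji}$ for all $1\le i,j\le n$. A positive weight vector $\mathbf{w}$ is called weakly efficient (with respect to $\mathbf{A}$) if there is no positive vector $\mathbf{w}'$ such that $|a_{ij}-w'_i/w'_j|<|a_{ij}-w_i/w_j|$ for all $1\le i\ne j\le n$. It is called strongly inefficient if it is not weakly efficient. A positive vector $\mathbf{w}'$ dominates $\mathbf{w}$ internally and strictly if for all $1\le i\ne j\le n$: $a_{ij}\le w_i/w_j$ implies $a_{ij}\le w'_i/w'_j<w_i/w_j$, and $a_{ij}\ge w_i/w_j$ implies $a_{ij}\ge w'_i/w'_j>w_i/w_j$. *)

theory Defs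
  imports "HOL-Analysis.Analysis"
begin

definition positive_vec :: "real^'n \<Rightarrow> bool" where
  "positive_vec w \<longleftrightarrow> (\<forall>i. w $ i > 0)"

definition pairwise_comparison_matrix :: "real^'n^'n \<Rightarrow> bool" where
  "pairwise_comparison_matrix A \<longleftrightarrow>
     CARD('n) \<ge> 3 \<and> (\<forall>i j. A $ i $ j > 0) \<and> (\<forall>i j. A $ i $ j = 1 / A $ j $ i)"

definition weakly_efficient :: "real^'n^'n \<Rightarrow> real^'n \<Rightarrow> bool" where
  "weakly_efficient A w \<longleftrightarrow> positive_vec w \<and>
     \<not> (\<exists>w'. positive_vec w' \<and>
          (\<forall>i j. i \<noteq> j \<longrightarrow>
             \<bar>A $ i $ j - w' $ i / w' $ j\<bar> < \<bar>A $ i $ j - w $ i / w $ j\<bar>))"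

definition strongly_inefficient :: "real^'n^'n \<Rightarrow> real^'n \<Rightarrow> bool" where
  "strongly_inefficient A w \<longleftrightarrow> positive_vec w \<and> \<not> weakly_efficient A w"

definition dominates_internally_strictly ::
    "real^'n^'n \<Rightarrow> real^'n \<Rightarrow> real^'n \<Rightarrow> bool" where
  "dominates_internally_strictly A w' w \<longleftrightarrow> positive_vec w' \<and>
     (\<forall>i j. i \<noteq> j \<longrightarrow>
        (A $ i $ j \<le> w $ i / w $ j \<longrightarrow>
           A $ i $ j \<le> w' $ i / w' $ j \<and> w' $ i / w' $ j < w $ i / w $ j) \<and>
        (A $ i $ j \<ge> w $ i / w $ j \<longrightarrow>
           A $ i $ j \<ge> w' $ i / w' $ j \<and> w' $ i / w' $ j > w $ i / w $ j))"

definition lp_index_set :: "real^'n^'n \<Rightarrow> real^'n \<Rightarrow> ('n \<times> 'n) set" where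
  "lp_index_set A w = {(i, j). A $ i $ j < w $ i / w $ j}"

text \<open>
  The linear program in the variables \<open>(y, s)\<close>. A finite index type has no distinguished
  first element, so the index whose variable is normalised to \<open>0\<close> is the parameter
  \<open>k\<close>; it plays the role of the index 1.
\<close>

definition lp_feasible :: "real^'n^'n \<Rightarrow> real^'n \<Rightarrow> 'n \<Rightarrow> (real^'n) \<times> real \<Rightarrow> bool" where
  "lp_feasible A w k = (\<lambda>(y, s).
     (let v = (\<lambda>i. ln (w $ i)); b = (\<lambda>i j. ln (A $ i $ j)) in
       (\<forall>(i, j) \<in> lp_index_set A w. y $ j - y $ i \<le> - b i j) \<and>
       (\<forall>(i, j) \<in> lp_index_set A w. y $ i - y $ j + s \<le> v i - v j) \<and>
       s \<ge> 0 \<and>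
       y $ k = 0))"

definition lp_objective :: "(real^'n) \<times> real \<Rightarrow> real" where
  "lp_objective = (\<lambda>(y, s). - s)"

definition lp_optimal_solution ::
    "real^'n^'n \<Rightarrow> real^'n \<Rightarrow> 'n \<Rightarrow> (real^'n) \<times> real \<Rightarrow> bool" where
  "lp_optimal_solution A w k = is_arg_min lp_objective (lp_feasible A w k)"

definition lp_optimum_value :: "real^'n^'n \<Rightarrow> real^'n \<Rightarrow> 'n \<Rightarrow> real \<Rightarrow> bool" where
  "lp_optimum_value A w k z \<longleftrightarrow>
     (\<exists>x. lp_optimal_solution A w k x \<and> z = lp_objective x)"

definition exp_vec :: "real^'n \<Rightarrow> real^'n" where
  "exp_vec y = (\<chi> i. exp (y $ i))"

end

theory Submission
  imports Defs
begin

text \<open>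
  In logarithmic coordinates a vector dominating \<open>w\<close> gives a direction in which every difference
  \<open>v i - v j\<close> with \<open>(i, j) \<in> I\<close> decreases; it may overshoot \<open>ln (A $ i $ j)\<close>, but a short enough
  step along it does not, and is therefore feasible with positive slack \<open>s\<close>. Conversely a feasible
  point with positive slack exponentiates to an internal strict dominator. If \<open>exp y\<^sup>*\<close>
  were itself dominated, the same short step taken from \<open>y\<^sup>*\<close> would increase the slack.
\<close>

section \<open>The linear program: each constrained pair confines \<open>y $ i - y $ j\<close> to an
  interval whose upper end is lowered by \<open>s\<close>\<close>

lemma lp_feasible_iff:
  "lp_feasible A w k (y, s) \<longleftrightarrow>
     (\<forall>i j. A $ i $ j < w $ i / w $ j \<longrightarrow>
        ln (A $ i $ j) \<le> y $ i - y $ j \<and> y $ i - y $ j + s \<le> ln (w $ i) - ln (w $ j)) \<and>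
     0 \<le> s \<and> y $ k = 0"
  unfolding lp_feasible_def lp_index_set_def Let_def
  by (fastforce simp: algebra_simps)

lemma lp_optimal_solution_iff:
  "lp_optimal_solution A w k (y, s) \<longleftrightarrow>
     lp_feasible A w k (y, s) \<and> (\<forall>y' s'. lp_feasible A w k (y', s') \<longrightarrow> s' \<le> s)"
  unfolding lp_optimal_solution_def is_arg_min_linorder lp_objective_def by auto

lemma less_quotient_iff_ln:
  fixes a x y :: real
  assumes "a > 0" "x > 0" "y > 0"
  shows "a < x / y \<longleftrightarrow> ln a < ln x - ln y"
proof -
  have "a < x / y \<longleftrightarrow> ln a < ln (x / y)"
    using assms by (subst ln_less_cancel_iff) auto
  then show ?thesis
    using assms(2,3) by (simp only: ln_divide_pos)
qed

section \<open>Reciprocity and the orientation of index pairs\<close>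

context
  fixes A :: "real^'n^'n"
  assumes pcm: "pairwise_comparison_matrix A"
begin

lemma pcm_pos: "A $ i $ j > 0"
  using pcm unfolding pairwise_comparison_matrix_def by (elim conjE allE)

lemma pcm_swap: "A $ i $ j = 1 / A $ j $ i"
proof -
  have "\<forall>i j. A $ i $ j = 1 / A $ j $ i"
    using pcm unfolding pairwise_comparison_matrix_def by (elim conjE)
  then show ?thesis by (elim allE)
qed

lemma pcm_diag: "A $ i $ i = 1"
proof -
  have "A $ i $ i * A $ i $ i = 1"
    using pcm_swap[of i i] pcm_pos[of i i]
    by (metis less_irrefl nonzero_divide_eq_eq)
  then show ?thesis
    using pcm_pos[of i i] square_eq_1_iff by force
qed

text \<open>Both sides equal 1 when \<open>i = j\<close>, so the index set contains no diagonal pair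
  although its definition allows one.\<close>

lemma pcm_less_imp_neq:
  assumes "positive_vec w" "A $ i $ j < w $ i / w $ j"
  shows "i \<noteq> j"
proof
  assume "i = j"
  moreover have "w $ j \<noteq> 0"
    using assms(1) unfolding positive_vec_def by (metis less_irrefl)
  ultimately show False
    using assms(2) pcm_diag[of j] by simp
qed

text \<open>Taking reciprocals reverses the order. Hence constraints on pairs with
  \<open>A $ i $ j\<close> below the quotient also control the pairs with \<open>A $ i $ j\<close>
  above it.\<close>

lemma pcm_less_swap:
  assumes "positive_vec w"
  shows "A $ i $ j > w $ i / w $ j \<longleftrightarrow> A $ j $ i < w $ j / w $ i"
proof -
  have "w $ i > 0" "w $ j > 0" using assms by (auto simp: positive_vec_def)
  then show ?thesis
    using pcm_pos[of j i] by (subst pcm_swap[of i j]) (simp add: field_simps)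
qed

section \<open>Feasible points and domination\<close>

lemma lp_feasible_self:
  assumes "positive_vec w"
  shows "lp_feasible A w k (\<chi> i. ln (w $ i) - ln (w $ k), 0)"
proof -
  have "ln (A $ i $ j) < ln (w $ i) - ln (w $ j)" if "A $ i $ j < w $ i / w $ j" for i j
    using that assms pcm_pos less_quotient_iff_ln unfolding positive_vec_def by blast
  then show ?thesis by (auto simp: lp_feasible_iff less_imp_le)
qed

lemma lp_feasible_dominates:
  assumes w: "positive_vec w"
    and ne: "\<And>i j. i \<noteq> j \<Longrightarrow> A $ i $ j \<noteq> w $ i / w $ j"
    and feas: "lp_feasible A w k (y, s)" and "s > 0"
  shows "dominates_internally_strictly A (exp_vec y) w"
proof -
  have key: "A $ i $ j \<le> exp (y $ i - y $ j) \<and> exp (y $ i - y $ j) < w $ i / w $ j"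
    if "A $ i $ j < w $ i / w $ j" for i j
  proof -
    have "ln (A $ i $ j) \<le> y $ i - y $ j" "y $ i - y $ j < ln (w $ i) - ln (w $ j)"
      using feas that \<open>s > 0\<close> by (force simp: lp_feasible_iff)+
    moreover have "exp (ln (w $ i) - ln (w $ j)) = w $ i / w $ j"
      using w by (simp add: exp_diff positive_vec_def)
    ultimately show ?thesis
      using pcm_pos[of i j] by (metis exp_le_cancel_iff exp_less_cancel_iff exp_ln)
  qed
  \<comment> \<open>The pair \<open>(j, i)\<close> is then constrained; inverting its two bounds
    gives these.\<close>
  have key': "A $ i $ j \<ge> exp (y $ i - y $ j) \<and> exp (y $ i - y $ j) > w $ i / w $ j"
    if "A $ i $ j > w $ i / w $ j" for i j
  proof -
    have *: "A $ j $ i \<le> exp (y $ j - y $ i)" "exp (y $ j - y $ i) < w $ j / w $ i"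
      using key[of j i] that w pcm_less_swap by blast+
    have "inverse (exp (y $ j - y $ i)) \<le> inverse (A $ j $ i)"
      "inverse (w $ j / w $ i) < inverse (exp (y $ j - y $ i))"
      using * pcm_pos[of j i] le_imp_inverse_le less_imp_inverse_less exp_gt_zero by blast+
    moreover have "inverse (exp (y $ j - y $ i)) = exp (y $ i - y $ j)"
      by (simp flip: exp_minus)
    ultimately show ?thesis
      using pcm_swap[of i j] by (simp add: inverse_eq_divide)
  qed
  \<comment> \<open>By \<open>ne\<close>, exactly one of \<open>key\<close> and \<open>key'\<close>
    applies to each off-diagonal pair. At equality the definition would demand two contradictory
    strict inequalities.\<close>
  show ?thesis
    unfolding dominates_internally_strictly_def
    using key key' ne by (force simp: positive_vec_def exp_vec_def simp flip: exp_diff)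
qed

text \<open>Each quotient moves strictly towards \<open>A $ i $ j\<close> without passing it, so its
  distance to that entry shrinks.\<close>

lemma dominates_internally_strictly_imp_not_weakly_efficient:
  assumes "dominates_internally_strictly A w' w"
  shows "\<not> weakly_efficient A w"
proof -
  have "\<bar>A $ i $ j - w' $ i / w' $ j\<bar> < \<bar>A $ i $ j - w $ i / w $ j\<bar>" if "i \<noteq> j" for i j
    using assms that unfolding dominates_internally_strictly_def
    by (cases "A $ i $ j \<le> w $ i / w $ j") fastforce+
  then show ?thesis
    using assms unfolding weakly_efficient_def dominates_internally_strictly_def by blast
qed

text \<open>Applied below both to \<open>w\<close> and to \<open>exp_vec y\<close> for an optimal
  \<open>y\<close>.\<close>

lemma not_weakly_efficient_imp_feasible_pos:
  assumes w: "positive_vec w" and "\<not> weakly_efficient A w"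
  obtains y s where "s > 0" "lp_feasible A w k (y, s)"
proof -
  obtain w' where w': "positive_vec w'"
    and lt: "\<And>i j. i \<noteq> j \<Longrightarrow> \<bar>A $ i $ j - w' $ i / w' $ j\<bar> < \<bar>A $ i $ j - w $ i / w $ j\<bar>"
    using assms unfolding weakly_efficient_def by blast
  define v u where "v i = ln (w $ i)" and "u i = ln (w' $ i)" for i
  define I where "I = {(i, j). A $ i $ j < w $ i / w $ j}"
  have gap: "ln (A $ i $ j) < v i - v j" if "(i, j) \<in> I" for i j
    using that w pcm_pos unfolding I_def v_def positive_vec_def by (simp add: less_quotient_iff_ln)
  have dec: "u i - u j < v i - v j" if "(i, j) \<in> I" for i j
  proof -
    \<comment> \<open>The old quotient lies above \<open>A $ i $ j\<close>; a strictly closer one,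
      on whichever side, must lie below the old one.\<close>
    have "w' $ i / w' $ j < w $ i / w $ j"
      using lt[of i j] that pcm_less_imp_neq[OF w, of i j] by (auto simp: I_def)
    then show ?thesis
      using w w' less_quotient_iff_ln[of "w' $ i / w' $ j" "w $ i" "w $ j"]
      by (simp add: u_def v_def positive_vec_def ln_divide_pos)
  qed
  have "finite I" by (rule finite_subset[OF subset_UNIV]) simp
  \<comment> \<open>At \<open>t = 0\<close> the bound is the strict inequality \<open>gap\<close>.
    By continuity it persists for small \<open>t\<close>, and uniformly so because \<open>I\<close>
    is finite.\<close>
  have small: "\<forall>\<^sub>F t in at_right 0. \<forall>p\<in>I. case p of (i, j) \<Rightarrow>
      ln (A $ i $ j) < (v i - v j) - t * ((v i - v j) - (u i - u j))"
  proof (intro eventually_ball_finite[OF \<open>finite I\<close>] ballI, clarify)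
    fix i j assume "(i, j) \<in> I"
    have "((\<lambda>t. (v i - v j) - t * ((v i - v j) - (u i - u j))) \<longlongrightarrow>
        (v i - v j) - 0 * ((v i - v j) - (u i - u j))) (at_right 0)"
      by (intro tendsto_intros)
    then show "\<forall>\<^sub>F t in at_right 0. ln (A $ i $ j) < (v i - v j) - t * ((v i - v j) - (u i - u j))"
      using gap[OF \<open>(i, j) \<in> I\<close>] by (intro order_tendstoD(1)) auto
  qed
  obtain t :: real where "t > 0" and t: "\<And>i j. (i, j) \<in> I \<Longrightarrow>
      ln (A $ i $ j) < (v i - v j) - t * ((v i - v j) - (u i - u j))"
    using eventually_happens'[OF _ eventually_conj[OF small eventually_at_right_less]]
    by (auto simp: trivial_limit_at_right_real)
  \<comment> \<open>\<open>Min S\<close> is a common positive lower bound for the full decreases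
    over \<open>I\<close>. The inserted 1 keeps \<open>S\<close> nonempty without an argument about
    \<open>I\<close>.\<close>
  define S where "S = insert 1 ((\<lambda>(i, j). (v i - v j) - (u i - u j)) ` I)"
  have "finite S" "S \<noteq> {}" using \<open>finite I\<close> by (auto simp: S_def)
  have "Min S > 0"
    using dec \<open>finite S\<close> by (auto simp: S_def Min_gr_iff)
  have minS: "Min S \<le> (v i - v j) - (u i - u j)" if "(i, j) \<in> I" for i j
    using that \<open>finite S\<close> by (intro Min_le) (auto simp: S_def)
  \<comment> \<open>The point at parameter \<open>t\<close> on the segment from \<open>v\<close> to
    \<open>u\<close>, shifted by a constant so that \<open>y $ k = 0\<close>; the shift cancels in
    all differences.\<close>
  define y where "y = (\<chi> i. (v i + t * (u i - v i)) - (v k + t * (u k - v k)))"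
  have y: "y $ i - y $ j = (v i - v j) - t * ((v i - v j) - (u i - u j))" for i j
    by (simp add: y_def algebra_simps)
  have "lp_feasible A w k (y, t * Min S)"
    unfolding lp_feasible_iff
  proof (intro conjI allI impI)
    fix i j assume "A $ i $ j < w $ i / w $ j"
    then have ij: "(i, j) \<in> I" by (simp add: I_def)
    show "ln (A $ i $ j) \<le> y $ i - y $ j"
      using t[OF ij] y by simp
    show "y $ i - y $ j + t * Min S \<le> ln (w $ i) - ln (w $ j)"
      using mult_left_mono[OF minS[OF ij]] \<open>t > 0\<close> unfolding y by (simp add: v_def)
  qed (use \<open>t > 0\<close> \<open>Min S > 0\<close> in \<open>auto simp: y_def\<close>)
  then show thesis
    using that[OF mult_pos_pos] \<open>t > 0\<close> \<open>Min S > 0\<close> by blast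
qed

section \<open>Compactness of the feasible set and existence of an optimum\<close>

lemma compact_lp_feasible:
  assumes w: "positive_vec w"
    and ne: "\<And>i j. i \<noteq> j \<Longrightarrow> A $ i $ j \<noteq> w $ i / w $ j"
  shows "compact {x. lp_feasible A w k x}"
proof -
  define F where "F = {x. lp_feasible A w k x}"
  have F: "F = {x. (\<forall>i j. A $ i $ j < w $ i / w $ j \<longrightarrow> ln (A $ i $ j) \<le> fst x $ i - fst x $ j \<and>
        fst x $ i - fst x $ j + snd x \<le> ln (w $ i) - ln (w $ j)) \<and> 0 \<le> snd x \<and> fst x $ k = 0}"
    unfolding F_def by (auto simp: lp_feasible_iff)
  have "closed F"
    unfolding F
    by (intro closed_Collect_conj closed_Collect_all closed_Collect_imp closed_Collect_le
        closed_Collect_eq open_Collect_const continuous_intros)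
  \<comment> \<open>Boundedness rests on \<open>ne\<close>: any two distinct indices are constrained
    in one of their two orders.\<close>
  have total: "A $ i $ j < w $ i / w $ j \<or> A $ j $ i < w $ j / w $ i" if "i \<noteq> j" for i j
    using ne[OF that] pcm_less_swap[OF w, of i j] by linarith
  \<comment> \<open>A point of an interval is bounded by the sum of the absolute values of its ends,
    and so is \<open>s\<close>, which cannot exceed the length of the interval.\<close>
  define c where "c i j = \<bar>ln (A $ i $ j)\<bar> + \<bar>ln (w $ i) - ln (w $ j)\<bar>" for i j
  have c_nonneg: "0 \<le> c i j" for i j by (simp add: c_def)
  have "\<bar>y $ i - y $ j\<bar> \<le> c i j \<and> \<bar>s\<bar> \<le> c i j"
    if "A $ i $ j < w $ i / w $ j" "(y, s) \<in> F" for i j y s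
  proof -
    have "ln (A $ i $ j) \<le> y $ i - y $ j" "y $ i - y $ j + s \<le> ln (w $ i) - ln (w $ j)" "0 \<le> s"
      using that unfolding F by auto
    then show ?thesis unfolding c_def by linarith
  qed
  \<comment> \<open>Adding \<open>c i j\<close> and \<open>c j i\<close> covers both possible orders
    of the constrained pair.\<close>
  then have diff: "\<bar>y $ i - y $ j\<bar> \<le> c i j + c j i \<and> \<bar>s\<bar> \<le> c i j + c j i"
    if "i \<noteq> j" "(y, s) \<in> F" for i j y s
    using total[OF \<open>i \<noteq> j\<close>] \<open>(y, s) \<in> F\<close> c_nonneg[of i j] c_nonneg[of j i]
      abs_minus_commute[of "y $ i" "y $ j"]
    by (smt (verit))
  \<comment> \<open>The slack is bounded only through a constraint between two distinct indices, so
    a partner for \<open>k\<close> is required.\<close>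
  have "\<exists>j. j \<noteq> k"
  proof (rule ccontr)
    assume "\<nexists>j. j \<noteq> k"
    then have "(UNIV :: 'n set) = {k}" by auto
    then have "CARD('n) = card {k}" by (rule arg_cong)
    moreover have "CARD('n) \<ge> 3"
      using pcm unfolding pairwise_comparison_matrix_def by (elim conjE)
    ultimately show False by simp
  qed
  then obtain j where "j \<noteq> k" by blast
  have "norm x \<le> (\<Sum>i\<in>UNIV. c i k + c k i) + c j k + c k j" if "x \<in> F" for x
  proof -
    obtain y s where x: "x = (y, s)" by fastforce
    have "y $ k = 0" using that unfolding x F by simp
    \<comment> \<open>The normalisation \<open>y $ k = 0\<close> turns bounds on differences into
      bounds on coordinates.\<close>
    have "\<bar>y $ i\<bar> \<le> c i k + c k i" for i
    proof (cases "i = k")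
      case True
      then show ?thesis using \<open>y $ k = 0\<close> by (simp add: c_def)
    next
      case False
      then show ?thesis using diff[of i k y s] that \<open>y $ k = 0\<close> x by simp
    qed
    then have "norm y \<le> (\<Sum>i\<in>UNIV. c i k + c k i)"
      by (intro order_trans[OF norm_le_l1_cart] sum_mono)
    moreover have "norm s \<le> c j k + c k j"
      using diff[OF \<open>j \<noteq> k\<close>] that x by simp
    ultimately show ?thesis
      using norm_Pair_le[of y s] unfolding x by linarith
  qed
  then have "bounded F" unfolding bounded_iff by blast
  with \<open>closed F\<close> show ?thesis
    by (simp add: compact_eq_bounded_closed F_def)
qed

lemma lp_optimal_solution_exists:
  assumes w: "positive_vec w"
    and ne: "\<And>i j. i \<noteq> j \<Longrightarrow> A $ i $ j \<noteq> w $ i / w $ j"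
  obtains y s where "lp_optimal_solution A w k (y, s)"
proof -
  have "{x. lp_feasible A w k x} \<noteq> {}"
    using lp_feasible_self[OF w] by blast
  moreover have "continuous_on {x. lp_feasible A w k x} snd"
    by (intro continuous_intros)
  ultimately obtain x where "lp_feasible A w k x"
    "\<And>x'. lp_feasible A w k x' \<Longrightarrow> snd x' \<le> snd x"
    using continuous_attains_sup[OF compact_lp_feasible[OF w ne], of k snd] by blast
  then have "lp_optimal_solution A w k (fst x, snd x)"
    unfolding lp_optimal_solution_iff by fastforce
  then show thesis using that by blast
qed

section \<open>Optimal slack and efficiency\<close>

lemma lp_optimal_solution_eq_0_iff:
  assumes w: "positive_vec w"
    and ne: "\<And>i j. i \<noteq> j \<Longrightarrow> A $ i $ j \<noteq> w $ i / w $ j"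
    and opt: "lp_optimal_solution A w k (y, s)"
  shows "s = 0 \<longleftrightarrow> weakly_efficient A w"
proof
  assume "s = 0"
  show "weakly_efficient A w"
  proof (rule ccontr)
    assume "\<not> weakly_efficient A w"
    then obtain y' s' where "s' > 0" "lp_feasible A w k (y', s')"
      using not_weakly_efficient_imp_feasible_pos[OF w] by blast
    then show False
      using opt \<open>s = 0\<close> by (fastforce simp: lp_optimal_solution_iff)
  qed
next
  assume eff: "weakly_efficient A w"
  have feas: "lp_feasible A w k (y, s)"
    using opt by (simp add: lp_optimal_solution_iff)
  have "\<not> s > 0"
    using lp_feasible_dominates[OF w ne feas] eff
      dominates_internally_strictly_imp_not_weakly_efficient by blast
  then show "s = 0"
    using feas by (simp add: lp_feasible_iff)
qed

text \<open>Slacks add up: a point with slack \<open>s'\<close> in the program of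
  \<open>exp_vec y\<close> has slack \<open>s + s'\<close> in the program of \<open>w\<close>, which
  contradicts optimality if \<open>s' > 0\<close>.\<close>

lemma lp_optimal_solution_weakly_efficient:
  assumes w: "positive_vec w" and opt: "lp_optimal_solution A w k (y, s)"
  shows "weakly_efficient A (exp_vec y)"
proof (rule ccontr)
  assume noneff: "\<not> weakly_efficient A (exp_vec y)"
  have pos: "positive_vec (exp_vec y)"
    by (simp add: positive_vec_def exp_vec_def)
  obtain w' where
    lt: "\<And>i j. i \<noteq> j \<Longrightarrow>
      \<bar>A $ i $ j - w' $ i / w' $ j\<bar> < \<bar>A $ i $ j - exp_vec y $ i / exp_vec y $ j\<bar>"
    using pos noneff unfolding weakly_efficient_def by blast
  obtain y' s' where "s' > 0" and feas': "lp_feasible A (exp_vec y) k (y', s')"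
    using not_weakly_efficient_imp_feasible_pos[OF pos noneff] by blast
  have feas: "lp_feasible A w k (y, s)"
    using opt by (simp add: lp_optimal_solution_iff)
  have "lp_feasible A w k (y', s + s')"
    unfolding lp_feasible_iff
  proof (intro conjI allI impI)
    fix i j assume ij: "A $ i $ j < w $ i / w $ j"
    have le: "ln (A $ i $ j) \<le> y $ i - y $ j" "y $ i - y $ j + s \<le> ln (w $ i) - ln (w $ j)"
      using feas ij by (auto simp: lp_feasible_iff)
    \<comment> \<open>The index set of \<open>w\<close> is contained in that of
      \<open>exp_vec y\<close>. Feasibility gives only a weak inequality; equality would mean
      distance 0, which \<open>w'\<close> could not undercut.\<close>
    have "A $ i $ j < exp_vec y $ i / exp_vec y $ j"
      proof -
      have "i \<noteq> j"
        using pcm_less_imp_neq[OF w ij] .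
      have "A $ i $ j \<le> exp (y $ i - y $ j)"
        using le(1) pcm_pos[of i j] by (metis exp_le_cancel_iff exp_ln)
      then show ?thesis
        using lt[OF \<open>i \<noteq> j\<close>] by (force simp: exp_vec_def exp_diff)
    qed
    then have "ln (A $ i $ j) \<le> y' $ i - y' $ j" "y' $ i - y' $ j + s' \<le> y $ i - y $ j"
      using feas' by (auto simp: lp_feasible_iff exp_vec_def)
    then show "ln (A $ i $ j) \<le> y' $ i - y' $ j"
      "y' $ i - y' $ j + (s + s') \<le> ln (w $ i) - ln (w $ j)"
      using le by linarith+
  qed (use feas feas' in \<open>auto simp: lp_feasible_iff\<close>)
  then show False
    using opt \<open>s' > 0\<close> by (fastforce simp: lp_optimal_solution_iff)
qed

end

theorem theorem5p1:
  fixes A :: "real^'n^'n" and w :: "real^'n" and k :: 'n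
  assumes "pairwise_comparison_matrix A"
    and "positive_vec w"
    and "\<forall>i j. i \<noteq> j \<longrightarrow> A $ i $ j \<noteq> w $ i / w $ j"
  shows "(\<exists>z. lp_optimum_value A w k z) \<and>
         (\<forall>z. lp_optimum_value A w k z \<longrightarrow> z \<le> 0 \<and> (z = 0 \<longleftrightarrow> weakly_efficient A w)) \<and>
         (\<forall>y s. lp_optimal_solution A w k (y, s) \<longrightarrow> strongly_inefficient A w \<longrightarrow>
            weakly_efficient A (exp_vec y) \<and> dominates_internally_strictly A (exp_vec y) w)"
proof (intro conjI allI impI)
  note pcm = assms(1) and w = assms(2)
  have ne: "A $ i $ j \<noteq> w $ i / w $ j" if "i \<noteq> j" for i j
    using assms(3) that by blast
  show "\<exists>z. lp_optimum_value A w k z"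
    using lp_optimal_solution_exists[OF pcm w ne] unfolding lp_optimum_value_def by blast
  fix z assume "lp_optimum_value A w k z"
  then obtain y s where opt: "lp_optimal_solution A w k (y, s)" and z: "z = - s"
    unfolding lp_optimum_value_def lp_objective_def by auto
  then have "lp_feasible A w k (y, s)"
    by (simp add: lp_optimal_solution_iff)
  then show "z \<le> 0"
    unfolding z by (simp add: lp_feasible_iff)
  show "z = 0 \<longleftrightarrow> weakly_efficient A w"
    using lp_optimal_solution_eq_0_iff[OF pcm w ne opt] unfolding z by simp
next
  note pcm = assms(1) and w = assms(2)
  fix y s assume opt: "lp_optimal_solution A w k (y, s)" and "strongly_inefficient A w"
  have ne: "A $ i $ j \<noteq> w $ i / w $ j" if "i \<noteq> j" for i j
    using assms(3) that by blast
  show "weakly_efficient A (exp_vec y)"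
    by (rule lp_optimal_solution_weakly_efficient[OF pcm w opt])
  have feas: "lp_feasible A w k (y, s)"
    using opt by (simp add: lp_optimal_solution_iff)
  \<comment> \<open>Strong inefficiency enters as a positive slack, which makes the domination
    strict.\<close>
  moreover have "s \<noteq> 0"
    using lp_optimal_solution_eq_0_iff[OF pcm w ne opt] \<open>strongly_inefficient A w\<close>
    by (simp add: strongly_inefficient_def)
  ultimately have "s > 0" by (simp add: lp_feasible_iff)
  then show "dominates_internally_strictly A (exp_vec y) w"
    using lp_feasible_dominates[OF pcm w ne feas] by blast
qed

end
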